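(* Suppose that $\{\tau_{in}\mid n=1,2,\ldots\}$, $i=0,1,2$, are mutually independent sequences, each consisting of independent and identically distributed nonnegative random variables with $0\le\mathbb{E}[\tau_{i1}]<\infty$ and $\mathbb{D}[\tau_{i1}]<\infty$ for $i=0,1,2$. Let $D_0(0)=D_1(0)=D_2(0)=0$ and, for $n=1,2,\ldots$, $$D_0(n)=D_0(n-1)+\tau_{0n},$$ $$D_1(n)=\max\bigl(\max(D_0(n),D_1(n-1))+\tau_{1n},\,D_2(n-1)\bigr),$$ $$D_2(n)=\max\bigl(D_1(n),D_2(n-1)\bigr)+\tau_{2n}.$$ Then $\mathbb{E}[D_1(n)]/n$ and $\mathbb{E}[D_2(n)]/n$ have a common limit $\gamma$ as $n\to\infty$, and $$\gamma=\max\bigl(\mathbb{E}[\tau_{01}],\,\mathbb{E}[\max(\tau_{11},\tau_{21})]\bigr).$$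
   Context: $\mathbb{E}$ denotes expectation and $\mathbb{D}$ denotes variance. The recursions model two single-server queues in tandem, initially empty, with an infinite buffer at the first server and a buffer of capacity $0$ at the second, operating under the manufacturing blocking rule (after completing a service, the first server remains busy until the second server completes its current service). Here $\tau_{0n}$ are interarrival times, $\tau_{in}$ ($i=1,2$) are the service times at server $i$, $D_0(n)$ is the $n$th arrival epoch, and $D_i(n)$ is the $n$th departure epoch from server $i$. The common limit $\gamma$ is the mean cycle time of the system. *)

theory Defs
  imports "HOL-Probability.Probability"
begin

end

theory Submission
  imports Defs
begin

text \<open>The blocking recursion collapses to
  \<open>D 1 n = max (D 0 n + \<tau> 1 n) (D 1 (n - 1) + max (\<tau> 1 n) (\<tau> 2 (n - 1)))\<close>, so \<open>D 1 n\<close> is the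
  longest path built from the random walk \<open>A\<close> of the arrivals and the random walk \<open>B\<close> with the
  i.i.d. steps \<open>max (\<tau> 1 (j + 1)) (\<tau> 2 j)\<close>. It dominates both \<open>A n\<close> and \<open>B (n - 1)\<close>, and it
  exceeds \<open>n \<gamma>\<close> by at most a constant number of maximal deviations of \<open>A\<close> and \<open>B\<close> from their
  means, up to terms of bounded expectation; the expected deviations are \<open>o(n)\<close> because the
  variances are finite.\<close>

section \<open>Independence of doubly indexed families\<close>

text \<open>A finite set of index pairs splits into rows with a fixed first index. The events of one
  row form a cylinder event of the whole row process, so \<open>outer\<close> factors the
  probability over the rows and \<open>inner\<close> factors each row.\<close>

lemma (in prob_space) indep_vars_Sigma:
  assumes outer: "indep_vars (\<lambda>i. Pi\<^sub>M (J i) (N i)) (\<lambda>i \<omega>. \<lambda>j\<in>J i. X i j \<omega>) I"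
    and inner: "\<And>i. i \<in> I \<Longrightarrow> indep_vars (N i) (X i) (J i)"
  shows "indep_vars (\<lambda>(i, j). N i j) (\<lambda>(i, j). X i j) (Sigma I J)"
  unfolding indep_vars_def2
proof (intro conjI ballI indep_setsI)
  show rv: "random_variable (case p of (i, j) \<Rightarrow> N i j) (case p of (i, j) \<Rightarrow> X i j)"
    if "p \<in> Sigma I J" for p
    using that inner by (auto simp: indep_vars_def2)
  show "{(case p of (i, j) \<Rightarrow> X i j) -` A \<inter> space M |A. A \<in> sets (case p of (i, j) \<Rightarrow> N i j)} \<subseteq> events"
    if "p \<in> Sigma I J" for p
    using rv[OF that] by (auto intro: measurable_sets)
next
  fix A K
  assume K: "K \<noteq> {}" "K \<subseteq> Sigma I J" "finite K"
    and A: "\<forall>p\<in>K. A p \<in> {(case p of (i, j) \<Rightarrow> X i j) -` B \<inter> space M |B.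
                             B \<in> sets (case p of (i, j) \<Rightarrow> N i j)}"
  have "\<exists>B. B \<in> sets (N (fst p) (snd p)) \<and> A p = X (fst p) (snd p) -` B \<inter> space M" if "p \<in> K" for p
    using A[rule_format, OF that] by (cases p) auto
  then obtain B where B: "\<And>p. p \<in> K \<Longrightarrow> B p \<in> sets (N (fst p) (snd p))"
    "\<And>p. p \<in> K \<Longrightarrow> A p = X (fst p) (snd p) -` B p \<inter> space M"
    by metis
  define L where "L i = {j. (i, j) \<in> K}" for i
  have L: "finite (L i)" "L i \<subseteq> J i" for i
  proof -
    have "L i \<subseteq> snd ` K" by (force simp: L_def)
    then show "finite (L i)" using K(3) by (meson finite_imageI finite_subset)
    show "L i \<subseteq> J i" using K(2) by (auto simp: L_def)
  qed
  have fstK: "fst ` K \<noteq> {}" "finite (fst ` K)" "fst ` K \<subseteq> I"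
    using K by auto
  \<comment> \<open>Empty rows must be excluded: an empty intersection is \<open>UNIV\<close>,
    whereas the preimages lie in \<open>space M\<close>.\<close>
  have ne: "L i \<noteq> {}" if "i \<in> fst ` K" for i
    using that by (auto simp: L_def)
  have Ksig: "K = Sigma (fst ` K) L"
    by (force simp: L_def)
  \<comment> \<open>The events of row \<open>i\<close>, expressed as one measurable cylinder over
    all of \<open>J i\<close>, since \<open>outer\<close> speaks only of full rows.\<close>
  define C where "C i = prod_emb (J i) (N i) (L i) (\<Pi>\<^sub>E j\<in>L i. B (i, j))" for i
  have C: "C i \<in> sets (Pi\<^sub>M (J i) (N i))" for i
    unfolding C_def using L[of i] B(1) by (intro sets_PiM_I) (auto simp: L_def)
  have vimage: "(\<lambda>\<omega>. \<lambda>j\<in>J i. X i j \<omega>) -` C i \<inter> space M = (\<Inter>j\<in>L i. A (i, j))"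
    if i: "i \<in> fst ` K" for i
  proof -
    have "X i j \<in> measurable M (N i j)" if "j \<in> J i" for j
      using inner[of i] i fstK that by (auto simp: indep_vars_def2)
    then have sp: "X i j \<omega> \<in> space (N i j)" if "j \<in> J i" "\<omega> \<in> space M" for j \<omega>
      using that by (auto dest: measurable_space)
    have Aij: "A (i, j) = X i j -` B (i, j) \<inter> space M" if "j \<in> L i" for j
      using B(2)[of "(i, j)"] that by (simp add: L_def)
    have "(\<lambda>j\<in>J i. X i j \<omega>) \<in> C i \<longleftrightarrow> (\<forall>j\<in>L i. X i j \<omega> \<in> B (i, j))" if "\<omega> \<in> space M" for \<omega>
      using sp that L(2)[of i] unfolding C_def prod_emb_def
      by (simp add: PiE_iff inf.absorb2 subset_iff)
    then show ?thesis
      using ne[OF i] Aij by auto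
  qed
  have "(\<Inter>p\<in>K. A p) = (\<Inter>p\<in>Sigma (fst ` K) L. A p)"
    by (rule INF_cong[OF Ksig refl])
  also have "\<dots> = (\<Inter>i\<in>fst ` K. \<Inter>j\<in>L i. A (i, j))"
    by blast
  finally have "prob (\<Inter>p\<in>K. A p) = prob (\<Inter>i\<in>fst ` K. \<Inter>j\<in>L i. A (i, j))"
    by simp
  also have "\<dots> = prob (\<Inter>i\<in>fst ` K. (\<lambda>\<omega>. \<lambda>j\<in>J i. X i j \<omega>) -` C i \<inter> space M)"
    using vimage by simp
  also have "\<dots> = (\<Prod>i\<in>fst ` K. prob ((\<lambda>\<omega>. \<lambda>j\<in>J i. X i j \<omega>) -` C i \<inter> space M))"
    by (intro indep_varsD[OF outer] fstK C)
  also have "\<dots> = (\<Prod>i\<in>fst ` K. \<Prod>j\<in>L i. prob (A (i, j)))"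
  proof (intro prod.cong refl)
    fix i assume i: "i \<in> fst ` K"
    have "prob (\<Inter>j\<in>L i. X i j -` B (i, j) \<inter> space M) = (\<Prod>j\<in>L i. prob (X i j -` B (i, j) \<inter> space M))"
      using i fstK B(1) L[of i] ne[OF i]
      by (intro indep_varsD[OF inner]) (auto simp: L_def)
    then show "prob ((\<lambda>\<omega>. \<lambda>j\<in>J i. X i j \<omega>) -` C i \<inter> space M) = (\<Prod>j\<in>L i. prob (A (i, j)))"
      unfolding vimage[OF i] using B(2) by (simp add: L_def)
  qed
  also have "\<dots> = (\<Prod>p\<in>Sigma (fst ` K) L. prob (A p))"
    using fstK L by (simp add: prod.Sigma)
  also have "\<dots> = (\<Prod>p\<in>K. prob (A p))"
    by (rule prod.cong[OF Ksig[symmetric] refl])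
  finally show "prob (\<Inter>p\<in>K. A p) = (\<Prod>p\<in>K. prob (A p))" .
qed

section \<open>Second moments and deviations of partial sums\<close>

text \<open>Induction on the index set: the new summand is independent of the sum of the others and
  has mean 0, so the cross term has mean 0.\<close>

lemma (in prob_space) second_moment_sum_indep_centered:
  fixes X :: "'i \<Rightarrow> 'a \<Rightarrow> real"
  assumes "finite I" "indep_vars (\<lambda>_. borel) X I"
    and "\<And>i. i \<in> I \<Longrightarrow> integrable M (X i)" "\<And>i. i \<in> I \<Longrightarrow> expectation (X i) = 0"
    and "\<And>i. i \<in> I \<Longrightarrow> integrable M (\<lambda>\<omega>. (X i \<omega>)\<^sup>2)"
  shows "integrable M (\<lambda>\<omega>. (\<Sum>i\<in>I. X i \<omega>)\<^sup>2)"
    and "expectation (\<lambda>\<omega>. (\<Sum>i\<in>I. X i \<omega>)\<^sup>2) = (\<Sum>i\<in>I. expectation (\<lambda>\<omega>. (X i \<omega>)\<^sup>2))"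
proof -
  have "integrable M (\<lambda>\<omega>. (\<Sum>i\<in>I. X i \<omega>)\<^sup>2) \<and>
      expectation (\<lambda>\<omega>. (\<Sum>i\<in>I. X i \<omega>)\<^sup>2) = (\<Sum>i\<in>I. expectation (\<lambda>\<omega>. (X i \<omega>)\<^sup>2))"
    using assms
  proof (induction I)
    case empty
    then show ?case by simp
  next
    case (insert i I)
    have IH: "integrable M (\<lambda>\<omega>. (\<Sum>i\<in>I. X i \<omega>)\<^sup>2)"
      "expectation (\<lambda>\<omega>. (\<Sum>i\<in>I. X i \<omega>)\<^sup>2) = (\<Sum>i\<in>I. expectation (\<lambda>\<omega>. (X i \<omega>)\<^sup>2))"
      using insert.IH insert.prems indep_vars_subset[OF insert.prems(1), of I] by auto
    have ind: "indep_var borel (X i) borel (\<lambda>\<omega>. \<Sum>i\<in>I. X i \<omega>)"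
      using insert by (intro indep_vars_sum) auto
    have int: "integrable M (X i)" "integrable M (\<lambda>\<omega>. \<Sum>i\<in>I. X i \<omega>)"
      using insert.prems by auto
    have cross: "integrable M (\<lambda>\<omega>. X i \<omega> * (\<Sum>i\<in>I. X i \<omega>))"
      "expectation (\<lambda>\<omega>. X i \<omega> * (\<Sum>i\<in>I. X i \<omega>)) = 0"
      using indep_var_integrable[OF ind int] indep_var_lebesgue_integral[OF ind int] insert.prems
      by auto
    have eq: "(\<Sum>i\<in>insert i I. X i \<omega>)\<^sup>2 =
        (X i \<omega>)\<^sup>2 + 2 * (X i \<omega> * (\<Sum>i\<in>I. X i \<omega>)) + (\<Sum>i\<in>I. X i \<omega>)\<^sup>2" for \<omega>
      using insert.hyps by (simp add: power2_sum)
    show ?case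
      unfolding eq using IH cross insert.prems insert.hyps by simp
  qed
  then show "integrable M (\<lambda>\<omega>. (\<Sum>i\<in>I. X i \<omega>)\<^sup>2)"
    and "expectation (\<lambda>\<omega>. (\<Sum>i\<in>I. X i \<omega>)\<^sup>2) = (\<Sum>i\<in>I. expectation (\<lambda>\<omega>. (X i \<omega>)\<^sup>2))"
    by auto
qed

text \<open>A single integrable majorant controls all deviations up to time \<open>n\<close>; the
  majorant may depend on \<open>e\<close>. It serves both for the arrivals and for the combined
  service times.\<close>

lemma (in prob_space) partial_sums_deviation:
  fixes X :: "nat \<Rightarrow> 'a \<Rightarrow> real"
  assumes ind: "indep_vars (\<lambda>_. borel) X {1..}"
    and int: "\<And>n. n \<ge> 1 \<Longrightarrow> integrable M (X n)"
    and mean: "\<And>n. n \<ge> 1 \<Longrightarrow> expectation (X n) = \<mu>"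
    and sq: "\<And>n. n \<ge> 1 \<Longrightarrow> integrable M (\<lambda>\<omega>. (X n \<omega> - \<mu>)\<^sup>2)"
    and var: "\<And>n. n \<ge> 1 \<Longrightarrow> expectation (\<lambda>\<omega>. (X n \<omega> - \<mu>)\<^sup>2) = V"
    and nonneg: "\<And>n. n \<ge> 1 \<Longrightarrow> AE \<omega> in M. 0 \<le> X n \<omega>"
    and "e > 0"
  obtains R where "\<And>n. integrable M (R n)"
    and "\<And>n. AE \<omega> in M. \<forall>k\<le>n. \<bar>(\<Sum>j=1..k. X j \<omega>) - real k * \<mu>\<bar> \<le> R n \<omega>"
    and "\<forall>\<^sub>F n in sequentially. expectation (R n) \<le> e * real n"
proof -
  \<comment> \<open>A third of \<open>e\<close> for each of the three summands of
    \<open>R n\<close>: a constant, the threshold \<open>\<delta> * real n\<close>, and a normalised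
    sum of squares.\<close>
  define \<delta> where "\<delta> = e / 3"
  have \<delta>: "\<delta> > 0" using \<open>e > 0\<close> by (simp add: \<delta>_def)
  have \<mu>: "\<mu> \<ge> 0"
    using integral_nonneg_AE[OF nonneg[of 1]] mean[of 1] by simp
  have V: "V \<ge> 0"
    using var[of 1] Bochner_Integration.integral_nonneg[of M "\<lambda>\<omega>. (X 1 \<omega> - \<mu>)\<^sup>2"] by simp
  \<comment> \<open>The grid spacing. For \<open>n \<ge> h\<close> there are at most
    \<open>3 * n / h\<close> grid points, each with second moment at most \<open>2 * n * V\<close>;
    dividing the total by \<open>\<delta> * n\<close> leaves
    \<open>6 * V * n / (h * \<delta>)\<close>, which is to be at most
    \<open>\<delta> * n\<close>.\<close>
  obtain h :: nat where h: "h \<ge> 1" "6 * V / \<delta>\<^sup>2 \<le> real h"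
  proof -
    obtain h where "6 * V / \<delta>\<^sup>2 \<le> real h" using real_arch_simple by blast
    then have "6 * V / \<delta>\<^sup>2 \<le> real (Suc h)" by simp
    then show thesis using that[of "Suc h"] by simp
  qed
  have h': "6 * V / (real h * \<delta>) \<le> \<delta>"
    using h \<delta> by (simp add: field_simps power2_eq_square)
  define T where "T k \<omega> = (\<Sum>j=1..k. X j \<omega>) - real k * \<mu>" for k \<omega>
  have T: "T k \<omega> = (\<Sum>j\<in>{1..k}. X j \<omega> - \<mu>)" for k \<omega>
    by (simp add: T_def sum_subtractf)
  have ind_c: "indep_vars (\<lambda>_. borel) (\<lambda>j \<omega>. X j \<omega> - \<mu>) {1..k}" for k
    by (intro indep_vars_compose2[where M' = "\<lambda>_. borel" and Y = "\<lambda>_ x. x - \<mu>"]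
        indep_vars_subset[OF ind]) auto
  have T2: "integrable M (\<lambda>\<omega>. (T k \<omega>)\<^sup>2)" "expectation (\<lambda>\<omega>. (T k \<omega>)\<^sup>2) = real k * V" for k
    unfolding T using second_moment_sum_indep_centered[OF _ ind_c[of k]] int mean sq var
    by (simp_all add: prob_space)
  \<comment> \<open>Bounding \<open>T\<close> on the grid \<open>h\<nat>\<close> only, and using monotonicity of the partial sums in between,
      makes Chebyshev-type second moments sufficient and a maximal inequality unnecessary.\<close>
  define R where "R n \<omega> = real h * \<mu> + \<delta> * real n
      + (\<Sum>i\<le>n div h + 1. (T (i * h) \<omega>)\<^sup>2) / (\<delta> * real n)" for n \<omega>
  have R_int: "integrable M (R n)" for n
    unfolding R_def using T2(1) by auto
  have "AE \<omega> in M. \<forall>j\<in>{1..}. 0 \<le> X j \<omega>"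
    using nonneg by (simp add: AE_ball_countable)
  then have R_bound: "AE \<omega> in M. \<forall>k\<le>n. \<bar>(\<Sum>j=1..k. X j \<omega>) - real k * \<mu>\<bar> \<le> R n \<omega>" for n
  proof eventually_elim
    case (elim \<omega>)
    show ?case
    proof (intro allI impI)
      fix k assume k: "k \<le> n"
      show "\<bar>(\<Sum>j=1..k. X j \<omega>) - real k * \<mu>\<bar> \<le> R n \<omega>"
      proof (cases "n = 0")
        case True
        \<comment> \<open>Division by zero gives 0, so \<open>R 0\<close> is
          \<open>h * \<mu>\<close>; only \<open>k = 0\<close>, with deviation 0, is to be
          covered.\<close>
        then show ?thesis using k \<mu> by (simp add: R_def)
      next
        case False
        then have dn: "\<delta> * real n > 0" using \<delta> by simp
        have grid: "\<bar>T (i * h) \<omega>\<bar> + real h * \<mu> \<le> R n \<omega>" if "i \<le> n div h + 1" for i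
        proof -
          let ?x = "\<bar>T (i * h) \<omega>\<bar>"
          \<comment> \<open>For \<open>c > 0\<close>, \<open>x \<le> c + x^2 / c\<close> trades the
            absolute value for a second moment: either \<open>x \<le> c\<close> or
            \<open>x \<le> x^2 / c\<close>.\<close>
          have "?x \<le> \<delta> * real n + ?x\<^sup>2 / (\<delta> * real n)"
          proof (cases "?x \<le> \<delta> * real n")
            case True
            have "0 \<le> ?x\<^sup>2 / (\<delta> * real n)" using dn by simp
            then show ?thesis using True by linarith
          next
            case False
            then have "?x * (\<delta> * real n) \<le> ?x * ?x" by (intro mult_left_mono) auto
            then have "?x \<le> ?x\<^sup>2 / (\<delta> * real n)"
              using dn by (simp add: pos_le_divide_eq power2_eq_square)
            then show ?thesis using dn by linarith
          qed
          moreover have "(T (i * h) \<omega>)\<^sup>2 \<le> (\<Sum>i\<le>n div h + 1. (T (i * h) \<omega>)\<^sup>2)"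
            using that by (intro member_le_sum) auto
          then have "?x\<^sup>2 / (\<delta> * real n) \<le> (\<Sum>i\<le>n div h + 1. (T (i * h) \<omega>)\<^sup>2) / (\<delta> * real n)"
            using dn by (intro divide_right_mono) auto
          ultimately show ?thesis unfolding R_def by linarith
        qed
        \<comment> \<open>The grid point following \<open>k\<close> may lie beyond \<open>n\<close>,
          which is why the sum in \<open>R n\<close> runs up to \<open>n div h + 1\<close>.\<close>
        define q where "q = k div h"
        have q: "q * h \<le> k" "k \<le> (q + 1) * h" "q \<le> n div h"
          using k h div_le_mono[OF k, of h] dividend_less_times_div[of h k]
          by (auto simp: q_def algebra_simps)
        have mono: "(\<Sum>j=1..a. X j \<omega>) \<le> (\<Sum>j=1..b. X j \<omega>)" if "a \<le> b" for a b
          using that elim by (intro sum_mono2) auto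
        have "T k \<omega> \<le> T ((q + 1) * h) \<omega> + (real ((q + 1) * h) - real k) * \<mu>"
          using mono[OF q(2)] by (simp add: T_def algebra_simps)
        also have "\<dots> \<le> T ((q + 1) * h) \<omega> + real h * \<mu>"
          using q(1) \<mu> by (intro add_left_mono mult_right_mono)
            (auto simp: algebra_simps simp flip: of_nat_mult of_nat_add)
        also have "\<dots> \<le> R n \<omega>"
          using grid[of "q + 1"] q(3) by simp
        finally have up: "T k \<omega> \<le> R n \<omega>" .
        have "T (q * h) \<omega> - (real k - real (q * h)) * \<mu> \<le> T k \<omega>"
          using mono[OF q(1)] by (simp add: T_def algebra_simps)
        moreover have "(real k - real (q * h)) * \<mu> \<le> real h * \<mu>"
          using q(2) \<mu> by (intro mult_right_mono)
            (auto simp: algebra_simps simp flip: of_nat_mult of_nat_add)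
        ultimately have "- R n \<omega> \<le> T k \<omega>"
          using grid[of q] q(3) by simp
        then show ?thesis using up by (simp add: T_def abs_le_iff)
      qed
    qed
  qed
  have "\<forall>\<^sub>F n in sequentially. real h * \<mu> / \<delta> \<le> real n"
    using filterlim_real_sequentially by (auto simp: filterlim_at_top)
  then have "\<forall>\<^sub>F n in sequentially. expectation (R n) \<le> e * real n"
    using eventually_ge_at_top[of h]
  proof eventually_elim
    case (elim n)
    then have n: "n > 0" "h \<le> n" "real h * \<mu> \<le> \<delta> * real n"
      using h \<delta> by (auto simp: field_simps)
    define q where "q = n div h"
    have qh: "real q * real h \<le> real n"
      unfolding q_def of_nat_mult[symmetric] of_nat_le_iff by simp
    \<comment> \<open>\<open>h \<le> n\<close> absorbs the rounding: the last grid point is at most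
      \<open>2 * n\<close>, and the number \<open>q + 2\<close> of grid points is at most
      \<open>3 * n / h\<close>.\<close>
    then have q: "real (q + 1) * real h \<le> 2 * real n" "real (q + 2) * real h \<le> 3 * real n"
      using n(2) by (auto simp: algebra_simps)
    have "(\<Sum>i\<le>q + 1. real (i * h) * V) \<le> (\<Sum>i\<le>q + 1. 2 * real n * V)"
    proof (intro sum_mono mult_right_mono V)
      fix i assume "i \<in> {..q + 1}"
      then have "real i * real h \<le> real (q + 1) * real h" by (intro mult_right_mono) auto
      then show "real (i * h) \<le> 2 * real n" using q(1) by simp
    qed
    also have "\<dots> = real (q + 2) * (2 * real n * V)" by simp
    also have "\<dots> \<le> 3 * real n / real h * (2 * real n * V)"
      using q(2) V h by (intro mult_right_mono) (auto simp: field_simps)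
    also have "\<dots> = 6 * V / (real h * \<delta>) * (\<delta> * real n * real n)"
      using \<delta> by (simp add: field_simps)
    also have "\<dots> \<le> \<delta> * (\<delta> * real n * real n)"
      using h' \<delta> by (intro mult_right_mono) auto
    finally have "(\<Sum>i\<le>q + 1. real (i * h) * V) / (\<delta> * real n) \<le> \<delta> * real n"
      using \<delta> n by (simp add: field_simps)
    moreover have "expectation (R n) = real h * \<mu> + \<delta> * real n
        + (\<Sum>i\<le>q + 1. real (i * h) * V) / (\<delta> * real n)"
      unfolding R_def q_def[symmetric] using T2 by (simp add: prob_space algebra_simps)
    moreover have "e * real n = 3 * (\<delta> * real n)" by (simp add: \<delta>_def)
    ultimately show ?case using n(3) by linarith
  qed
  with R_int R_bound show thesis by (rule that)
qed

section \<open>Deterministic analysis of a sample path\<close>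

text \<open>One outcome of the system with all service and interarrival times nonnegative; almost
  every outcome is of this kind, so the pathwise bounds need no probability.\<close>

locale tandem_path =
  fixes t d :: "nat \<Rightarrow> nat \<Rightarrow> real"
  assumes nonneg: "\<And>i n. i \<in> {0, 1, 2} \<Longrightarrow> n \<ge> 1 \<Longrightarrow> 0 \<le> t i n"
    and init: "\<And>i. i \<in> {0, 1, 2} \<Longrightarrow> d i 0 = 0"
    and rec0: "\<And>n. n \<ge> 1 \<Longrightarrow> d 0 n = d 0 (n - 1) + t 0 n"
    and rec1: "\<And>n. n \<ge> 1 \<Longrightarrow> d 1 n = max (max (d 0 n) (d 1 (n - 1)) + t 1 n) (d 2 (n - 1))"
    and rec2: "\<And>n. n \<ge> 1 \<Longrightarrow> d 2 n = max (d 1 n) (d 2 (n - 1)) + t 2 n"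
begin

lemma d0_eq_sum: "d 0 n = (\<Sum>j=1..n. t 0 j)"
  by (induction n) (use init rec0 in auto)

text \<open>Blocking lets customer \<open>n\<close> leave the first server only when the second is
  free, so there is no wait between the servers.\<close>

lemma d2_eq: "n \<ge> 1 \<Longrightarrow> d 2 n = d 1 n + t 2 n"
  using rec1[of n] rec2[of n] by auto

lemma d1_one: "d 1 1 = d 0 1 + t 1 1"
  using rec1[of 1] rec0[of 1] init nonneg[of 0 1] nonneg[of 1 1] by simp

text \<open>Blocking makes the service of customer \<open>n + 1\<close> at the first server overlap with that of
  customer \<open>n\<close> at the second, so the two servers act as one with service time
  \<open>max (t 1 (n + 1)) (t 2 n)\<close>.\<close>

lemma d1_Suc: "n \<ge> 1 \<Longrightarrow> d 1 (Suc n) = max (d 0 (Suc n) + t 1 (Suc n)) (d 1 n + max (t 1 (Suc n)) (t 2 n))"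
  using rec1[of "Suc n"] d2_eq[of n] by (auto simp: max_def)

lemma d0_le_d1: "n \<ge> 1 \<Longrightarrow> d 0 n \<le> d 1 n"
  using rec1[of n] nonneg[of 1 n] by auto

lemma sum_max_le_d1: "(\<Sum>j=1..n. max (t 1 (Suc j)) (t 2 j)) \<le> d 1 (Suc n)"
proof (induction n)
  case 0
  show ?case using d0_le_d1[of 1] rec0[of 1] init nonneg[of 0 1] by simp
next
  case (Suc n)
  then show ?case using d1_Suc[of "Suc n"] by simp
qed

text \<open>After subtracting the walk \<open>S\<close> of combined service times, the recursion
  becomes a running maximum of arrival terms. Each such term is bounded through the deviations
  \<open>R\<close> and \<open>R'\<close>, and adding \<open>S n\<close> back costs a second
  \<open>R'\<close>.\<close>

lemma d1_le:
  assumes a: "a \<le> g" and b: "b \<le> g" and g: "0 \<le> g"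
    and A: "\<And>k. k \<le> Suc n \<Longrightarrow> \<bar>(\<Sum>j=1..k. t 0 j) - real k * a\<bar> \<le> R"
    and B: "\<And>k. k \<le> n \<Longrightarrow> \<bar>(\<Sum>j=1..k. max (t 1 (Suc j)) (t 2 j)) - real k * b\<bar> \<le> R'"
  shows "d 1 (Suc n) \<le> t 1 1 + 2 * g + real n * g + R + 2 * R'"
proof -
  define S where "S k = (\<Sum>j=1..k. max (t 1 (Suc j)) (t 2 j))" for k
  have R': "R' \<ge> 0" using B[of 0] by simp
  have d0: "d 0 (Suc k) - real (Suc k) * a \<le> R" if "k \<le> n" for k
    using A[of "Suc k"] that unfolding d0_eq_sum by simp
  \<comment> \<open>The right-hand side does not depend on \<open>m\<close>, so the old branch of
    the maximum is covered by the induction hypothesis as it stands.\<close>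
  have "d 1 (Suc m) - S m \<le> t 1 1 + 2 * g + real n * (g - b) + R + R'" if "m \<le> n" for m
    using that
  proof (induction m)
    case 0
    have "0 \<le> real n * (g - b)" using b by simp
    then show ?case using d0[of 0] d1_one a g R' by (simp add: S_def)
  next
    case (Suc m)
    have Sm: "S (Suc m) = S m + max (t 1 (Suc (Suc m))) (t 2 (Suc m))" by (simp add: S_def)
    have "d 0 (Suc (Suc m)) \<le> real (Suc (Suc m)) * a + R"
      using d0[of "Suc m"] Suc.prems by simp
    also have "\<dots> \<le> real (Suc (Suc m)) * g + R"
      using a by (intro add_right_mono mult_left_mono) auto
    finally have "d 0 (Suc (Suc m)) \<le> real (Suc (Suc m)) * g + R" .
    moreover have "real m * b - S m \<le> R'"
      using B[of m] Suc.prems by (simp add: S_def abs_le_iff)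
    moreover have "real m * (g - b) \<le> real n * (g - b)"
      using b Suc.prems by (intro mult_right_mono) auto
    ultimately have "d 0 (Suc (Suc m)) - S m \<le> 2 * g + real n * (g - b) + R + R'"
      by (simp add: algebra_simps)
    \<comment> \<open>The service time on the left is absorbed by the last step of \<open>S\<close>,
      so no maximum of individual service times has to be estimated.\<close>
    then have "d 0 (Suc (Suc m)) + t 1 (Suc (Suc m)) - S (Suc m) \<le> 2 * g + real n * (g - b) + R + R'"
      unfolding Sm by linarith
    then show ?case
      using Suc.IH Suc.prems d1_Suc[of "Suc m"] nonneg[of 1 1] unfolding Sm by simp
  qed
  \<comment> \<open>\<open>S n \<le> n * b + R'\<close> turns \<open>n * (g - b)\<close> into
    \<open>n * g\<close>.\<close>
  from this[of n] show ?thesis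
    using B[of n] by (simp add: S_def abs_le_iff algebra_simps)
qed

end

section \<open>Transfer between equal laws and passage to the limit\<close>

lemma
  fixes f :: "'b \<Rightarrow> real"
  assumes "distr M N X = distr M N Y" "X \<in> measurable M N" "Y \<in> measurable M N"
    "f \<in> borel_measurable N"
  shows integrable_cong_distr: "integrable M (\<lambda>\<omega>. f (X \<omega>)) \<longleftrightarrow> integrable M (\<lambda>\<omega>. f (Y \<omega>))"
    and integral_cong_distr: "(\<integral>\<omega>. f (X \<omega>) \<partial>M) = (\<integral>\<omega>. f (Y \<omega>) \<partial>M)"
  using assms by (metis integrable_distr_eq, metis integral_distr)

lemma (in prob_space) indep_var_of_indep_vars:
  assumes "indep_vars N X I" "i \<in> I" "j \<in> I" "i \<noteq> j"
  shows "indep_var (N i) (X i) (N j) (X j)"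
proof -
  have "indep_var (N i) ((\<lambda>f. f i) \<circ> (\<lambda>\<omega>. \<lambda>i\<in>{i}. X i \<omega>)) (N j) ((\<lambda>f. f j) \<circ> (\<lambda>\<omega>. \<lambda>i\<in>{j}. X i \<omega>))"
    using assms by (intro indep_var_compose[OF indep_var_restrict[OF assms(1)]]) auto
  then show ?thesis by (simp add: comp_def)
qed

text \<open>Under independence the joint law is the product of the marginals.\<close>

lemma (in prob_space) distr_pair_cong:
  assumes "indep_var S X T Y" "indep_var S X' T Y'"
    and "distr M S X = distr M S X'" "distr M T Y = distr M T Y'"
  shows "distr M (S \<Otimes>\<^sub>M T) (\<lambda>\<omega>. (X \<omega>, Y \<omega>)) = distr M (S \<Otimes>\<^sub>M T) (\<lambda>\<omega>. (X' \<omega>, Y' \<omega>))"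
  using assms by (simp add: indep_var_distribution_eq)

text \<open>The bounds pair \<open>f (Suc n)\<close> with \<open>n\<close> because
  \<open>D 1 (Suc n)\<close> contains only \<open>n\<close> combined services; the shift costs the
  factor \<open>n / Suc n\<close>, which tends to 1.\<close>

lemma tendsto_mean_of_sandwich:
  fixes f :: "nat \<Rightarrow> real"
  assumes lower: "\<And>n. real n * g \<le> f (Suc n)"
    and upper: "\<And>e. e > 0 \<Longrightarrow> \<forall>\<^sub>F n in sequentially. f (Suc n) \<le> real n * (g + e)"
  shows "(\<lambda>n. f n / real n) \<longlonglongrightarrow> g"
proof -
  have "(\<lambda>n. f (Suc n) / real n) \<longlonglongrightarrow> g"
  proof (rule tendstoI)
    fix e :: real assume "e > 0"
    show "\<forall>\<^sub>F n in sequentially. dist (f (Suc n) / real n) g < e"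
      using upper[OF half_gt_zero[OF \<open>e > 0\<close>]] eventually_gt_at_top[of 0]
    proof eventually_elim
      case (elim n)
      then have "g \<le> f (Suc n) / real n" "f (Suc n) / real n \<le> g + e / 2"
        using lower[of n] by (auto simp: field_simps)
      then show ?case using \<open>e > 0\<close> by (simp add: dist_real_def)
    qed
  qed
  then have "(\<lambda>n. f (Suc n) / real n * (real n / real (Suc n))) \<longlonglongrightarrow> g * 1"
    by (intro tendsto_mult LIMSEQ_n_over_Suc_n)
  moreover have "\<forall>\<^sub>F n in sequentially. f (Suc n) / real n * (real n / real (Suc n)) = f (Suc n) / real (Suc n)"
    using eventually_gt_at_top[of 0] by eventually_elim auto
  ultimately have "(\<lambda>n. f (Suc n) / real (Suc n)) \<longlonglongrightarrow> g"
    unfolding mult_1_right by (rule Lim_transform_eventually)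
  then show ?thesis by (rule LIMSEQ_imp_Suc)
qed

theorem mainTheorem2:
  fixes M :: "'a measure"
    and \<tau> :: "nat \<Rightarrow> nat \<Rightarrow> 'a \<Rightarrow> real"
    and D :: "nat \<Rightarrow> nat \<Rightarrow> 'a \<Rightarrow> real"
  assumes "prob_space M"
    and seqs_indep:
      "prob_space.indep_vars M (\<lambda>i. \<Pi>\<^sub>M n\<in>{1..}. borel) (\<lambda>i \<omega>. \<lambda>n\<in>{1..}. \<tau> i n \<omega>) {0, 1, 2}"
    and indep:
      "\<And>i. i \<in> {0, 1, 2} \<Longrightarrow> prob_space.indep_vars M (\<lambda>n. borel) (\<tau> i) {1..}"
    and ident_distr:
      "\<And>i n. i \<in> {0, 1, 2} \<Longrightarrow> n \<ge> 1 \<Longrightarrow> distr M borel (\<tau> i n) = distr M borel (\<tau> i 1)"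
    and nonneg:
      "\<And>i n. i \<in> {0, 1, 2} \<Longrightarrow> n \<ge> 1 \<Longrightarrow> AE \<omega> in M. 0 \<le> \<tau> i n \<omega>"
    and mean_finite:
      "\<And>i. i \<in> {0, 1, 2} \<Longrightarrow> integrable M (\<tau> i 1)"
    and mean_nonneg:
      "\<And>i. i \<in> {0, 1, 2} \<Longrightarrow> 0 \<le> prob_space.expectation M (\<tau> i 1)"
    and variance_finite:
      "\<And>i. i \<in> {0, 1, 2} \<Longrightarrow>
         integrable M (\<lambda>\<omega>. (\<tau> i 1 \<omega> - prob_space.expectation M (\<tau> i 1))\<^sup>2)"
    and D_init:
      "\<And>i \<omega>. i \<in> {0, 1, 2} \<Longrightarrow> \<omega> \<in> space M \<Longrightarrow> D i 0 \<omega> = 0"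
    and D0_rec:
      "\<And>n \<omega>. n \<ge> 1 \<Longrightarrow> \<omega> \<in> space M \<Longrightarrow> D 0 n \<omega> = D 0 (n - 1) \<omega> + \<tau> 0 n \<omega>"
    and D1_rec:
      "\<And>n \<omega>. n \<ge> 1 \<Longrightarrow> \<omega> \<in> space M \<Longrightarrow>
         D 1 n \<omega> = max (max (D 0 n \<omega>) (D 1 (n - 1) \<omega>) + \<tau> 1 n \<omega>) (D 2 (n - 1) \<omega>)"
    and D2_rec:
      "\<And>n \<omega>. n \<ge> 1 \<Longrightarrow> \<omega> \<in> space M \<Longrightarrow>
         D 2 n \<omega> = max (D 1 n \<omega>) (D 2 (n - 1) \<omega>) + \<tau> 2 n \<omega>"
  shows "\<exists>\<gamma>::real.
      (\<lambda>n. prob_space.expectation M (D 1 n) / real n) \<longlonglongrightarrow> \<gamma> \<and>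
      (\<lambda>n. prob_space.expectation M (D 2 n) / real n) \<longlonglongrightarrow> \<gamma> \<and>
      \<gamma> = max (prob_space.expectation M (\<tau> 0 1))
              (prob_space.expectation M (\<lambda>\<omega>. max (\<tau> 1 1 \<omega>) (\<tau> 2 1 \<omega>)))"
proof -

  \<comment> \<open>Independence, laws and moments of the combined service times\<close>
  interpret prob_space M by fact
  let ?I = "{0, 1, 2} :: nat set"
  define a where "a = expectation (\<tau> 0 1)"
  define b where "b = expectation (\<lambda>\<omega>. max (\<tau> 1 1 \<omega>) (\<tau> 2 1 \<omega>))"
  define g where "g = max a b"
  define Y where "Y j \<omega> = max (\<tau> 1 (Suc j) \<omega>) (\<tau> 2 j \<omega>)" for j \<omega>

  \<comment> \<open>\<open>Y\<close> mixes entries of two sequences, so independence is needed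
    jointly over all pairs of indices.\<close>
  have indep_all: "indep_vars (\<lambda>_. borel) (\<lambda>(i, n). \<tau> i n) (?I \<times> {1..})"
    using indep_vars_Sigma[OF seqs_indep indep] by (simp add: case_prod_unfold)
  have rv: "\<tau> i n \<in> borel_measurable M" if "i \<in> ?I" "n \<ge> 1" for i n
    using indep[OF that(1)] that(2) by (auto simp: indep_vars_def)
  note rv_simps = rv[of 0, simplified] rv[of 1, simplified] rv[of 2, simplified]

  have int_\<tau>: "integrable M (\<tau> i n)" if "i \<in> ?I" "n \<ge> 1" for i n
    using integrable_cong_distr[OF ident_distr[OF that] rv rv, of "\<lambda>x. x"] mean_finite[of i] that
    by auto
  have mean_\<tau>: "expectation (\<tau> i n) = expectation (\<tau> i 1)" if "i \<in> ?I" "n \<ge> 1" for i n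
    using integral_cong_distr[OF ident_distr[OF that] rv rv, of "\<lambda>x. x"] that by auto
  have sq_\<tau>: "integrable M (\<lambda>\<omega>. (\<tau> i 1 \<omega>)\<^sup>2)" if "i \<in> ?I" for i
  proof -
    let ?m = "expectation (\<tau> i 1)"
    have "integrable M (\<lambda>\<omega>. (\<tau> i 1 \<omega> - ?m)\<^sup>2 + (2 * ?m * \<tau> i 1 \<omega> - ?m\<^sup>2))"
      using variance_finite[OF that] mean_finite[OF that] by auto
    then show ?thesis by (simp add: power2_diff algebra_simps)
  qed

  have distr_Y: "distr M borel (Y j) = distr M borel (\<lambda>\<omega>. max (\<tau> 1 1 \<omega>) (\<tau> 2 1 \<omega>))" if "j \<ge> 1" for j
  proof -
    \<comment> \<open>The shifted pair has the law of the pair with both indices 1, which is how the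
      unshifted maximum enters the formula for the limit.\<close>
    have pair: "distr M (borel \<Otimes>\<^sub>M borel) (\<lambda>\<omega>. (\<tau> 1 (Suc j) \<omega>, \<tau> 2 j \<omega>)) =
        distr M (borel \<Otimes>\<^sub>M borel) (\<lambda>\<omega>. (\<tau> 1 1 \<omega>, \<tau> 2 1 \<omega>))"
      using that indep_var_of_indep_vars[OF indep_all, of "(1, Suc j)" "(2, j)"]
        indep_var_of_indep_vars[OF indep_all, of "(1, 1)" "(2, 1)"]
        ident_distr[of 1 "Suc j"] ident_distr[of 2 j]
      by (intro distr_pair_cong) auto
    have "distr M borel (Y j) = distr (distr M (borel \<Otimes>\<^sub>M borel) (\<lambda>\<omega>. (\<tau> 1 (Suc j) \<omega>, \<tau> 2 j \<omega>)))
        borel (\<lambda>(x, y). max x y)"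
      using rv_simps that by (subst distr_distr) (auto simp: comp_def Y_def[abs_def])
    also have "\<dots> = distr M borel (\<lambda>\<omega>. max (\<tau> 1 1 \<omega>) (\<tau> 2 1 \<omega>))"
      unfolding pair using rv_simps by (subst distr_distr) (auto simp: comp_def)
    finally show ?thesis .
  qed
  have rv_Y: "Y j \<in> borel_measurable M" if "j \<ge> 1" for j
    using rv_simps that by (auto simp: Y_def[abs_def])
  have int_Y: "integrable M (Y j)" if "j \<ge> 1" for j
    unfolding Y_def using that by (intro integrable_max int_\<tau>) auto
  have rv_max: "(\<lambda>\<omega>. max (\<tau> 1 1 \<omega>) (\<tau> 2 1 \<omega>)) \<in> borel_measurable M"
    using rv_simps by auto
  have mean_Y: "expectation (Y j) = b" if "j \<ge> 1" for j
    using integral_cong_distr[OF distr_Y[OF that] rv_Y[OF that] rv_max, of "\<lambda>x. x"]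
    by (simp add: b_def)
  \<comment> \<open>The square of the maximum is dominated by the sum of the squares; recentring at
    \<open>b\<close> then gives finite variance.\<close>
  have "integrable M (\<lambda>\<omega>. (max (\<tau> 1 1 \<omega>) (\<tau> 2 1 \<omega>))\<^sup>2)"
  proof (rule Bochner_Integration.integrable_bound)
    show "integrable M (\<lambda>\<omega>. (\<tau> 1 1 \<omega>)\<^sup>2 + (\<tau> 2 1 \<omega>)\<^sup>2)" using sq_\<tau> by auto
  qed (use rv_max in \<open>auto simp: max_def\<close>)
  then have "integrable M (\<lambda>\<omega>. (max (\<tau> 1 1 \<omega>) (\<tau> 2 1 \<omega>))\<^sup>2 +
      (b\<^sup>2 - 2 * b * max (\<tau> 1 1 \<omega>) (\<tau> 2 1 \<omega>)))"
    using mean_finite by auto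
  then have var_max: "integrable M (\<lambda>\<omega>. (max (\<tau> 1 1 \<omega>) (\<tau> 2 1 \<omega>) - b)\<^sup>2)"
    by (simp add: power2_diff algebra_simps)
  have indep_Y: "indep_vars (\<lambda>_. borel) Y {1..}"
  proof -
    \<comment> \<open>The index blocks are disjoint for different \<open>j\<close>, so functions of
      the separate blocks are independent.\<close>
    let ?K = "\<lambda>j. {(1, Suc j), (2, j)} :: (nat \<times> nat) set"
    have "indep_vars (\<lambda>j. Pi\<^sub>M (?K j) (\<lambda>_. borel)) (\<lambda>j \<omega>. \<lambda>p\<in>?K j. (case p of (i, n) \<Rightarrow> \<tau> i n) \<omega>) {1..}"
      by (rule indep_vars_restrict[OF indep_all]) (auto simp: disjoint_family_on_def)
    then have "indep_vars (\<lambda>_. borel) (\<lambda>j \<omega>. (\<lambda>f. max (f (1, Suc j)) (f (2, j)))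
        (\<lambda>p\<in>?K j. (case p of (i, n) \<Rightarrow> \<tau> i n) \<omega>)) {1..}"
      by (rule indep_vars_compose2) auto
    then show ?thesis by (simp add: Y_def[abs_def])
  qed

  \<comment> \<open>Almost sure paths and integrability of the departure epochs\<close>
  have "AE \<omega> in M. \<forall>i\<in>?I. \<forall>n\<in>{1..}. 0 \<le> \<tau> i n \<omega>"
    using nonneg by (simp add: AE_ball_countable)
  then have path: "AE \<omega> in M. tandem_path (\<lambda>i n. \<tau> i n \<omega>) (\<lambda>i n. D i n \<omega>)"
    using AE_space
  proof eventually_elim
    case (elim \<omega>)
    then show ?case using D_init D0_rec D1_rec D2_rec by unfold_locales auto
  qed

  \<comment> \<open>Measurability of the \<open>D i n\<close> comes out of the same induction,
    carried through the recursions.\<close>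
  have int_D: "integrable M (D 0 n) \<and> integrable M (D 1 n) \<and> integrable M (D 2 n)" for n
  proof (induction n)
    case 0
    have "integrable M (D i 0) \<longleftrightarrow> integrable M (\<lambda>_. 0 :: real)" if "i \<in> ?I" for i
      using D_init[OF that] by (intro Bochner_Integration.integrable_cong) auto
    then show ?case by simp
  next
    case (Suc n)
    have "integrable M (D 0 (Suc n)) \<longleftrightarrow> integrable M (\<lambda>\<omega>. D 0 n \<omega> + \<tau> 0 (Suc n) \<omega>)"
      using D0_rec[of "Suc n"] by (intro Bochner_Integration.integrable_cong) auto
    then have 0: "integrable M (D 0 (Suc n))" using Suc int_\<tau> by auto
    have "integrable M (D 1 (Suc n)) \<longleftrightarrow>
        integrable M (\<lambda>\<omega>. max (max (D 0 (Suc n) \<omega>) (D 1 n \<omega>) + \<tau> 1 (Suc n) \<omega>) (D 2 n \<omega>))"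
      using D1_rec[of "Suc n"] by (intro Bochner_Integration.integrable_cong) auto
    then have 1: "integrable M (D 1 (Suc n))" using 0 Suc int_\<tau> by auto
    have "integrable M (D 2 (Suc n)) \<longleftrightarrow>
        integrable M (\<lambda>\<omega>. max (D 1 (Suc n) \<omega>) (D 2 n \<omega>) + \<tau> 2 (Suc n) \<omega>)"
      using D2_rec[of "Suc n"] by (intro Bochner_Integration.integrable_cong) auto
    then show ?case using 0 1 Suc int_\<tau> by auto
  qed

  have g: "a \<le> g" "b \<le> g" "0 \<le> g"
    using mean_nonneg[of 0] by (auto simp: g_def a_def)

  \<comment> \<open>Lower bound from the two random walks\<close>
  have lower: "real n * g \<le> expectation (D 1 (Suc n))" for n
  proof -
    have "expectation (\<lambda>\<omega>. \<Sum>j=1..Suc n. \<tau> 0 j \<omega>) = (\<Sum>j=1..Suc n. expectation (\<tau> 0 j))"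
      using int_\<tau> by (intro Bochner_Integration.integral_sum) auto
    also have "\<dots> = (\<Sum>j=1..Suc n. a)"
      unfolding a_def by (intro sum.cong refl mean_\<tau>) auto
    \<comment> \<open>One nonnegative mean is dropped so that both lower bounds carry the factor
      \<open>n\<close>.\<close>
    also have "\<dots> \<ge> real n * a"
      using mean_nonneg[of 0] by (simp add: a_def algebra_simps)
    finally have "real n * a \<le> expectation (\<lambda>\<omega>. \<Sum>j=1..Suc n. \<tau> 0 j \<omega>)" .
    also have "\<dots> \<le> expectation (D 1 (Suc n))"
    proof (rule integral_mono_AE)
      show "AE \<omega> in M. (\<Sum>j=1..Suc n. \<tau> 0 j \<omega>) \<le> D 1 (Suc n) \<omega>"
        using path
      proof eventually_elim
        case (elim \<omega>)
        then show ?case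
          using tandem_path.d0_le_d1[OF elim, of "Suc n"] tandem_path.d0_eq_sum[OF elim, of "Suc n"]
          by simp
      qed
    qed (use int_D int_\<tau> in \<open>auto simp del: sum.cl_ivl_Suc intro!: Bochner_Integration.integrable_sum\<close>)
    finally have "real n * a \<le> expectation (D 1 (Suc n))" .
    moreover have "real n * b = expectation (\<lambda>\<omega>. \<Sum>j=1..n. Y j \<omega>)"
      using int_Y mean_Y by simp
    moreover have "\<dots> \<le> expectation (D 1 (Suc n))"
    proof (rule integral_mono_AE)
      show "AE \<omega> in M. (\<Sum>j=1..n. Y j \<omega>) \<le> D 1 (Suc n) \<omega>"
        using path by eventually_elim (use tandem_path.sum_max_le_d1 in \<open>simp add: Y_def\<close>)
    qed (use int_D int_Y in \<open>auto intro!: Bochner_Integration.integrable_sum\<close>)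
    ultimately show ?thesis by (auto simp: g_def max_def)
  qed

  \<comment> \<open>Upper bound from the deviations\<close>
  have upper: "\<forall>\<^sub>F n in sequentially. expectation (D 1 (Suc n)) \<le> real n * (g + e)" if "e > 0" for e
  proof -
    \<comment> \<open>Of the five shares of \<open>e * n\<close>, one goes to \<open>R\<close>, two
      to the doubled \<open>R'\<close> and one to the constant \<open>c\<close>; the last is
      slack.\<close>
    have e5: "e / 5 > 0" using that by simp
    obtain R where R: "\<And>n. integrable M (R n)"
      "\<And>n. AE \<omega> in M. \<forall>k\<le>n. \<bar>(\<Sum>j=1..k. \<tau> 0 j \<omega>) - real k * a\<bar> \<le> R n \<omega>"
      "\<forall>\<^sub>F n in sequentially. expectation (R n) \<le> e / 5 * real n"
    proof (rule partial_sums_deviation[OF indep[of 0] _ _ _ _ _ e5])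
      fix n :: nat assume n: "n \<ge> 1"
      show "integrable M (\<tau> 0 n)" using int_\<tau> n by simp
      show "expectation (\<tau> 0 n) = a" using mean_\<tau>[of 0 n] n by (simp add: a_def)
      show "integrable M (\<lambda>\<omega>. (\<tau> 0 n \<omega> - a)\<^sup>2)"
        using integrable_cong_distr[OF ident_distr[of 0 n] rv rv, of "\<lambda>x. (x - a)\<^sup>2"]
          variance_finite[of 0] n by (simp add: a_def)
      show "expectation (\<lambda>\<omega>. (\<tau> 0 n \<omega> - a)\<^sup>2) = expectation (\<lambda>\<omega>. (\<tau> 0 1 \<omega> - a)\<^sup>2)"
        using integral_cong_distr[OF ident_distr[of 0 n] rv rv, of "\<lambda>x. (x - a)\<^sup>2"] n by simp
      show "AE \<omega> in M. 0 \<le> \<tau> 0 n \<omega>" using nonneg n by simp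
    qed auto
    obtain R' where R': "\<And>n. integrable M (R' n)"
      "\<And>n. AE \<omega> in M. \<forall>k\<le>n. \<bar>(\<Sum>j=1..k. Y j \<omega>) - real k * b\<bar> \<le> R' n \<omega>"
      "\<forall>\<^sub>F n in sequentially. expectation (R' n) \<le> e / 5 * real n"
    proof (rule partial_sums_deviation[OF indep_Y _ _ _ _ _ e5])
      fix n :: nat assume n: "n \<ge> 1"
      show "integrable M (Y n)" "expectation (Y n) = b" using int_Y mean_Y n by auto
      show "integrable M (\<lambda>\<omega>. (Y n \<omega> - b)\<^sup>2)"
        using integrable_cong_distr[OF distr_Y[OF n] rv_Y[OF n] rv_max, of "\<lambda>x. (x - b)\<^sup>2"] var_max
        by simp
      show "expectation (\<lambda>\<omega>. (Y n \<omega> - b)\<^sup>2) = expectation (\<lambda>\<omega>. (max (\<tau> 1 1 \<omega>) (\<tau> 2 1 \<omega>) - b)\<^sup>2)"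
        using integral_cong_distr[OF distr_Y[OF n] rv_Y[OF n] rv_max, of "\<lambda>x. (x - b)\<^sup>2"] by simp
      show "AE \<omega> in M. 0 \<le> Y n \<omega>"
        using nonneg[of 2 n] n by (auto simp: Y_def le_max_iff_disj)
    qed auto
    \<comment> \<open>The term \<open>e / 5\<close> pays for evaluating \<open>R\<close> at
      \<open>Suc n\<close> instead of \<open>n\<close>.\<close>
    define c where "c = expectation (\<tau> 1 1) + 2 * g + e / 5"
    have bound: "expectation (D 1 (Suc n)) \<le>
        expectation (\<tau> 1 1) + 2 * g + real n * g + expectation (R (Suc n)) + 2 * expectation (R' n)" for n
    proof -
      have "expectation (D 1 (Suc n)) \<le>
          expectation (\<lambda>\<omega>. \<tau> 1 1 \<omega> + 2 * g + real n * g + R (Suc n) \<omega> + 2 * R' n \<omega>)"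
      proof (rule integral_mono_AE)
        show "AE \<omega> in M. D 1 (Suc n) \<omega> \<le> \<tau> 1 1 \<omega> + 2 * g + real n * g + R (Suc n) \<omega> + 2 * R' n \<omega>"
          using path R(2)[of "Suc n"] R'(2)[of n]
        proof eventually_elim
          case (elim \<omega>)
          show ?case
            by (rule tandem_path.d1_le[OF elim(1) g]) (use elim in \<open>auto simp: Y_def\<close>)
        qed
      qed (use int_D int_\<tau> R(1) R'(1) in auto)
      also have "\<dots> = expectation (\<tau> 1 1) + 2 * g + real n * g + expectation (R (Suc n)) + 2 * expectation (R' n)"
        using int_\<tau>[of 1 1] R(1) R'(1) by (simp add: prob_space)
      finally show ?thesis .
    qed
    have "\<forall>\<^sub>F n in sequentially. 5 * c / e \<le> real n"
      using filterlim_real_sequentially by (auto simp: filterlim_at_top)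
    moreover have "\<forall>\<^sub>F n in sequentially. expectation (R (Suc n)) \<le> e / 5 * real (Suc n)"
      using R(3) eventually_sequentially_Suc[of "\<lambda>n. expectation (R n) \<le> e / 5 * real n"] by blast
    ultimately show ?thesis
      using R'(3)
    proof eventually_elim
      case (elim n)
      then have "c \<le> e / 5 * real n" using that by (simp add: field_simps)
      moreover have "expectation (R (Suc n)) \<le> e / 5 * real n + e / 5"
        using elim(2) by (simp add: algebra_simps)
      moreover have "real n * (g + e) = real n * g + 5 * (e / 5 * real n)"
        by (simp add: algebra_simps)
      moreover have "0 \<le> e / 5 * real n" using that by simp
      ultimately show ?case
        using bound[of n] elim(3) unfolding c_def by linarith
    qed
  qed

  \<comment> \<open>The common limit of both means\<close>
  have lim1: "(\<lambda>n. expectation (D 1 n) / real n) \<longlonglongrightarrow> g"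
    using lower upper by (rule tendsto_mean_of_sandwich)
  \<comment> \<open>The two means differ by a constant, which vanishes after division by
    \<open>n\<close>.\<close>
  have mean_D2: "expectation (D 2 n) = expectation (D 1 n) + expectation (\<tau> 2 1)" if "n \<ge> 1" for n
  proof -
    have "expectation (D 2 n) = expectation (\<lambda>\<omega>. D 1 n \<omega> + \<tau> 2 n \<omega>)"
    proof (rule integral_cong_AE)
      show "AE \<omega> in M. D 2 n \<omega> = D 1 n \<omega> + \<tau> 2 n \<omega>"
        using path by eventually_elim (use that tandem_path.d2_eq in fast)
    qed (use int_D[of n] int_\<tau>[of 2 n] that in auto)
    also have "\<dots> = expectation (D 1 n) + expectation (\<tau> 2 1)"
      using int_D[of n] int_\<tau>[of 2 n] mean_\<tau>[of 2 n] that by simp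
    finally show ?thesis .
  qed
  have "(\<lambda>n. expectation (D 1 n) / real n + expectation (\<tau> 2 1) / real n) \<longlonglongrightarrow> g + 0"
    by (intro tendsto_add lim1 lim_const_over_n)
  moreover have "\<forall>\<^sub>F n in sequentially. expectation (D 1 n) / real n + expectation (\<tau> 2 1) / real n =
      expectation (D 2 n) / real n"
    using eventually_ge_at_top[of 1] by eventually_elim (simp add: mean_D2 add_divide_distrib)
  ultimately have lim2: "(\<lambda>n. expectation (D 2 n) / real n) \<longlonglongrightarrow> g"
    unfolding add_0_right by (rule Lim_transform_eventually)
  show ?thesis
    using lim1 lim2 by (auto simp: g_def a_def b_def)
qed

end
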